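(* Let $I\subseteq K[\mathbf{x}]=K[x_1,\ldots,x_n]$ be a zero dimensional ideal, i.e. $\dim_K(K[\mathbf{x}]/I)<\infty$. Then $I$ has a standard basis with respect to any local ordering $\prec$.
   Context: $K$ is a field, $n\ge 1$, $\mathbb{N}=\{0,1,2,\ldots\}$, $\mathcal{M}=\{\mathbf{x}^{\alpha}\mid\alpha\in\mathbb{N}^n\}$. For a total ordering $\prec$ on $\mathcal{M}$ (not necessarily compatible with multiplication) and nonzero $f\in K[\mathbf{x}]$, $LM(f)$ is the $\prec$-largest monomial occurring in $f$ with nonzero coefficient. For a finite set $G\subset K[\mathbf{x}]$, $L(G)=\{LM(\mathbf{x}^\alpha g)\mid \mathbf{x}^\alpha\in\mathcal{M}, g\in G\}$; for an ideal $I$, $L(I)=\{LM(g)\mid g\in I\}$ (nonzero $g$ only). $\prec$ is normal if for all nonzero $f$ and all $\mathbf{x}^\alpha\in\mathcal{M}$: $\mathbf{x}^\alpha\prec 1\Rightarrow LM(\mathbf{x}^\alpha f)\prec LM(f)$. A local ordering is a normal ordering with $x_i\prec1$ for $1\le i\le n$. For a normal ordering, $S_\prec=\{g\in K[\mathbf{x}]\mid LM(g)=1\}$ is multiplicatively closed; $S_\prec^{-1}I$ denotes the localisation of $I$ and $\overline{I}=S_\prec^{-1}I\cap K[\mathbf{x}]$. (For a local ordering $S_\prec^{-1}K[\mathbf{x}]=K[\mathbf{x}]_{(x_1,\ldots,x_n)}$.) A standard basis of $I$ is a finite set $G\subseteq\overline{I}$ with $L(G)=L(I)$. *)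

theory Defs
  imports
    Complex_Main
    "HOL-Library.Poly_Mapping"
    "HOL-Computational_Algebra.Fraction_Field"
    "HOL-Computational_Algebra.Polynomial_Factorial"
begin

text \<open>
  A monomial is identified with its exponent vector, so multiplication of monomials is addition
  and the monomial \<open>1\<close> is the exponent vector \<open>0\<close>. The variables are indexed by a type \<open>'n\<close>,
  which will be finite in the statement: the polynomial ring then has \<open>n = CARD('n) \<ge> 1\<close> variables.
  Multiplication of polynomials is the convolution product of \<open>Poly_Mapping\<close>.
\<close>

type_synonym 'n monomial = "'n \<Rightarrow>\<^sub>0 nat"
type_synonym ('n, 'k) polynomial = "'n monomial \<Rightarrow>\<^sub>0 'k"

definition monom_poly :: "'n monomial \<Rightarrow> ('n, 'k::zero_neq_one) polynomial" where
  "monom_poly \<alpha> = Poly_Mapping.single \<alpha> 1"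

definition scale_poly :: "'k::comm_ring_1 \<Rightarrow> ('n, 'k) polynomial \<Rightarrow> ('n, 'k) polynomial" where
  "scale_poly c f = Poly_Mapping.single 0 c * f"

global_interpretation poly_space: vector_space "scale_poly :: 'k::field \<Rightarrow> ('n, 'k) polynomial \<Rightarrow> _"
  by unfold_locales
    (simp_all add: scale_poly_def distrib_left distrib_right single_add mult_single
      flip: mult.assoc)

definition is_ideal :: "'a::comm_ring_1 set \<Rightarrow> bool" where
  "is_ideal I \<longleftrightarrow>
     0 \<in> I \<and> (\<forall>f\<in>I. \<forall>g\<in>I. f + g \<in> I) \<and> (\<forall>h. \<forall>f\<in>I. h * f \<in> I)"

text \<open>
  \<open>UNIV // ideal_cong I\<close> is the quotient ring by \<open>I\<close>. It is finite dimensional over \<open>'k\<close> iff it is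
  spanned by the residue classes of a finite set \<open>B\<close> of polynomials. (The ideal \<open>I = UNIV\<close>, with
  quotient of dimension \<open>0\<close>, is included.)
\<close>

definition ideal_cong :: "'a::comm_ring_1 set \<Rightarrow> ('a \<times> 'a) set" where
  "ideal_cong I = {(f, g). f - g \<in> I}"

definition zero_dimensional :: "('n, 'k::field) polynomial set \<Rightarrow> bool" where
  "zero_dimensional I \<longleftrightarrow>
     (\<exists>B. finite B \<and> UNIV // ideal_cong I = (\<lambda>f. ideal_cong I `` {f}) ` poly_space.span B)"

definition strict_total_order :: "('a \<Rightarrow> 'a \<Rightarrow> bool) \<Rightarrow> bool" where
  "strict_total_order prec \<longleftrightarrow> irreflp prec \<and> transp prec \<and> totalp prec"

text \<open>Only meaningful for a nonzero polynomial, hence the conditions \<open>\<noteq> 0\<close> below.\<close>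

definition LM :: "('n monomial \<Rightarrow> 'n monomial \<Rightarrow> bool) \<Rightarrow> ('n, 'k::zero) polynomial \<Rightarrow> 'n monomial"
  where "LM prec f =
    (THE m. m \<in> Poly_Mapping.keys f \<and> (\<forall>m'\<in>Poly_Mapping.keys f. m' \<noteq> m \<longrightarrow> prec m' m))"

text \<open>
  The two meanings of \<open>L\<close>: for a finite set \<open>G\<close> (all monomial multiples of elements of \<open>G\<close> are
  taken) and for an ideal \<open>I\<close>.
\<close>

definition L_set ::
    "('n monomial \<Rightarrow> 'n monomial \<Rightarrow> bool) \<Rightarrow> ('n, 'k::comm_ring_1) polynomial set \<Rightarrow> 'n monomial set"
  where "L_set prec G = {LM prec (monom_poly \<alpha> * g) | \<alpha> g. g \<in> G \<and> g \<noteq> 0}"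

definition L_ideal ::
    "('n monomial \<Rightarrow> 'n monomial \<Rightarrow> bool) \<Rightarrow> ('n, 'k::comm_ring_1) polynomial set \<Rightarrow> 'n monomial set"
  where "L_ideal prec I = {LM prec g | g. g \<in> I \<and> g \<noteq> 0}"

text \<open>
  Orderings need not be compatible with multiplication. Normality quantifies over all polynomials
  with coefficients in \<open>'k\<close>, which is why the coefficient field appears as an argument.
\<close>

definition normal_ordering ::
    "'k::field itself \<Rightarrow> ('n monomial \<Rightarrow> 'n monomial \<Rightarrow> bool) \<Rightarrow> bool"
  where "normal_ordering K prec \<longleftrightarrow>
    strict_total_order prec \<and>
    (\<forall>(f :: ('n, 'k) polynomial) \<alpha>.
       f \<noteq> 0 \<longrightarrow> prec \<alpha> 0 \<longrightarrow> prec (LM prec (monom_poly \<alpha> * f)) (LM prec f))"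

definition local_ordering ::
    "'k::field itself \<Rightarrow> ('n monomial \<Rightarrow> 'n monomial \<Rightarrow> bool) \<Rightarrow> bool"
  where "local_ordering K prec \<longleftrightarrow>
    normal_ordering K prec \<and> (\<forall>i. prec (Poly_Mapping.single i 1) 0)"

definition S_prec ::
    "('n monomial \<Rightarrow> 'n monomial \<Rightarrow> bool) \<Rightarrow> ('n, 'k::field) polynomial set"
  where "S_prec prec = {g. g \<noteq> 0 \<and> LM prec g = 0}"

text \<open>
  Localisation of \<open>I\<close> at \<open>S\<close> (where \<open>0 \<notin> S\<close>), formed inside the field of fractions of the integral
  domain \<open>'a\<close>. For polynomials, the type class \<open>linorder\<close> on the index type of the variables is
  what makes them an instance of \<open>idom\<close>; this auxiliary order is unrelated to \<open>prec\<close>.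
\<close>

definition localisation :: "'a::idom set \<Rightarrow> 'a set \<Rightarrow> 'a fract set" where
  "localisation S I = {Fract f s | f s. f \<in> I \<and> s \<in> S}"

definition ideal_closure ::
    "('n::linorder monomial \<Rightarrow> 'n monomial \<Rightarrow> bool) \<Rightarrow> ('n, 'k::field) polynomial set
       \<Rightarrow> ('n, 'k) polynomial set"
  where "ideal_closure prec I = {g. to_fract g \<in> localisation (S_prec prec) I}"

definition standard_basis ::
    "('n::linorder monomial \<Rightarrow> 'n monomial \<Rightarrow> bool) \<Rightarrow> ('n, 'k::field) polynomial set
       \<Rightarrow> ('n, 'k) polynomial set \<Rightarrow> bool"
  where "standard_basis prec I G \<longleftrightarrow>
    finite G \<and> G \<subseteq> ideal_closure prec I \<and> L_set prec G = L_ideal prec I"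

end

theory Submission
  imports Defs "HOL-Library.FuncSet"
begin

text \<open>
  Write \<open>J\<close> for the closure of \<open>I\<close>. For a local ordering every monomial other than \<open>1\<close> lies
  below \<open>1\<close>, and multiplying a nonzero \<open>g\<close> by such a monomial lowers its leading monomial.
  Hence multiplying \<open>g\<close> by some \<open>s\<close> with leading monomial \<open>1\<close>, i.e. by a nonzero constant plus
  lower terms, does not change the leading monomial (\<open>LM_mult_S_prec\<close>). As \<open>g \<in> J\<close> means
  \<open>g * s \<in> I\<close> for such an \<open>s\<close>, the leading monomials of elements of \<open>J\<close> are those of elements of
  \<open>I\<close>, so \<open>L(G) \<subseteq> L(I)\<close> for every \<open>G \<subseteq> J\<close>.

  Zero-dimensionality makes the powers of each variable \<open>x\<^sub>i\<close> linearly dependent modulo \<open>I\<close>, so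
  \<open>I\<close> contains a nonzero polynomial in \<open>x\<^sub>i\<close> alone. Such a polynomial is \<open>x\<^sub>i\<^sup>d * u\<close> with \<open>u\<close>
  of nonzero constant term, and a polynomial with nonzero constant term has leading monomial \<open>1\<close>.
  Therefore \<open>x\<^sub>i\<^sup>d \<in> J\<close> (\<open>variable_power_in_closure\<close>).

  Only finitely many monomials are divisible by none of these pure powers. A standard basis consists
  of the pure powers together with, for each of the finitely many such monomials in \<open>L(I)\<close>, one
  element of \<open>I\<close> having it as leading monomial. The multiples of the pure powers are themselves
  monomials, so their leading monomials are immediate for any ordering.
\<close>

section \<open>Leading monomials\<close>

lemma LM_eqI:
  assumes "strict_total_order prec" "m \<in> Poly_Mapping.keys f"
    and "\<And>m'. m' \<in> Poly_Mapping.keys f \<Longrightarrow> m' \<noteq> m \<Longrightarrow> prec m' m"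
  shows "LM prec f = m"
  unfolding LM_def
proof (rule the_equality)
  fix k
  assume k: "k \<in> Poly_Mapping.keys f \<and> (\<forall>m'\<in>Poly_Mapping.keys f. m' \<noteq> k \<longrightarrow> prec m' k)"
  show "k = m"
  proof (rule ccontr)
    assume "k \<noteq> m"
    then have "prec k m" "prec m k"
      using k assms(2,3) by auto
    then show False
      using assms(1) by (meson strict_total_order_def irreflpD transpD)
  qed
qed (use assms in auto)

lemma LM_greatest:
  assumes ord: "strict_total_order prec" and "f \<noteq> 0"
  shows "LM prec f \<in> Poly_Mapping.keys f"
    and "m \<in> Poly_Mapping.keys f \<Longrightarrow> m \<noteq> LM prec f \<Longrightarrow> prec m (LM prec f)"
proof -
  have "\<exists>m\<in>A. \<forall>m'\<in>A. m' \<noteq> m \<longrightarrow> prec m' m" if "finite A" "A \<noteq> {}" for A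
    using that
  proof (induction A rule: finite_ne_induct)
    case (insert x F)
    then obtain m where m: "m \<in> F" "\<forall>m'\<in>F. m' \<noteq> m \<longrightarrow> prec m' m"
      by blast
    consider "x = m" | "prec x m" | "prec m x"
      using ord by (metis strict_total_order_def totalpD)
    then show ?case
    proof cases
      case 3
      then have "\<forall>m'\<in>F. prec m' x"
        using m ord by (metis strict_total_order_def transpD)
      then show ?thesis by auto
    qed (use m in auto)
  qed auto
  moreover have "Poly_Mapping.keys f \<noteq> {}"
    using \<open>f \<noteq> 0\<close> by simp
  ultimately obtain k where k: "k \<in> Poly_Mapping.keys f"
      "\<forall>m'\<in>Poly_Mapping.keys f. m' \<noteq> k \<longrightarrow> prec m' k"
    using finite_keys by blast
  then have "LM prec f = k"
    by (intro LM_eqI[OF ord]) auto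
  then show "LM prec f \<in> Poly_Mapping.keys f"
    and "m \<in> Poly_Mapping.keys f \<Longrightarrow> m \<noteq> LM prec f \<Longrightarrow> prec m (LM prec f)"
    using k by auto
qed

lemma monom_poly_neq_0: "monom_poly \<alpha> \<noteq> (0 :: ('n, 'k::zero_neq_one) polynomial)"
  unfolding monom_poly_def by (metis lookup_single_eq lookup_zero zero_neq_one)

lemma lookup_scale_poly:
  "Poly_Mapping.lookup (scale_poly c f) m = c * Poly_Mapping.lookup f m"
  by (simp add: scale_poly_def Poly_Mapping.map.rep_eq when_def flip: mult_map_scale_conv_mult)

lemma sum_single_lookup:
  "(\<Sum>\<alpha>\<in>Poly_Mapping.keys f. Poly_Mapping.single \<alpha> (Poly_Mapping.lookup f \<alpha>)) = f"
  by (rule poly_mapping_eqI) (simp add: lookup_sum lookup_single when_def in_keys_iff)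

lemma LM_monom_poly:
  "strict_total_order prec \<Longrightarrow> LM prec (monom_poly \<alpha> :: ('n, 'k::zero_neq_one) polynomial) = \<alpha>"
  by (rule LM_eqI) (auto simp: monom_poly_def)

lemma monom_poly_mult:
  "monom_poly \<alpha> * monom_poly \<beta> = (monom_poly (\<alpha> + \<beta>) :: ('n, 'k::comm_ring_1) polynomial)"
  by (simp add: monom_poly_def mult_single)

text \<open>
  By normality, multiplying a monomial by a single variable gives a lower monomial, so every
  monomial is reached from \<open>1\<close> by a descending chain.
\<close>

lemma local_ordering_less_zero:
  fixes prec :: "'n::finite monomial \<Rightarrow> 'n monomial \<Rightarrow> bool"
  assumes loc: "local_ordering TYPE('k::field) prec" and "\<alpha> \<noteq> 0"
  shows "prec \<alpha> 0"
  using \<open>\<alpha> \<noteq> 0\<close>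
proof (induction "\<Sum>i\<in>UNIV. Poly_Mapping.lookup \<alpha> i" arbitrary: \<alpha> rule: less_induct)
  case less
  have ord: "strict_total_order prec"
    using loc by (simp add: local_ordering_def normal_ordering_def)
  obtain i where i: "Poly_Mapping.lookup \<alpha> i > 0"
    using less.prems by (metis gr0I poly_mapping_eqI lookup_zero)
  define \<beta> where "\<beta> = \<alpha> - Poly_Mapping.single i 1"
  have \<alpha>: "\<alpha> = Poly_Mapping.single i 1 + \<beta>"
    using i by (intro poly_mapping_eqI)
      (auto simp: \<beta>_def lookup_add lookup_minus lookup_single when_def)
  have "(monom_poly \<beta> :: ('n, 'k) polynomial) \<noteq> 0"
    by (rule monom_poly_neq_0)
  then have "prec (LM prec (monom_poly (Poly_Mapping.single i 1) * monom_poly \<beta> :: ('n, 'k) polynomial))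
      (LM prec (monom_poly \<beta> :: ('n, 'k) polynomial))"
    using loc by (simp add: local_ordering_def normal_ordering_def)
  then have "prec \<alpha> \<beta>"
    by (simp add: monom_poly_mult LM_monom_poly[OF ord] \<alpha>)
  moreover have "prec \<beta> 0" if "\<beta> \<noteq> 0"
  proof (rule less.hyps[OF _ that])
    show "(\<Sum>j\<in>UNIV. Poly_Mapping.lookup \<beta> j) < (\<Sum>j\<in>UNIV. Poly_Mapping.lookup \<alpha> j)"
      by (rule sum_strict_mono_ex1) (auto simp: \<alpha> lookup_add intro!: exI[of _ i])
  qed
  ultimately show ?case
    using ord by (metis strict_total_order_def transpD)
qed

lemma S_precI:
  fixes prec :: "'n::finite monomial \<Rightarrow> 'n monomial \<Rightarrow> bool" and u :: "('n, 'k::field) polynomial"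
  assumes loc: "local_ordering TYPE('k) prec" and u: "Poly_Mapping.lookup u 0 \<noteq> 0"
  shows "u \<in> S_prec prec"
proof -
  have "LM prec u = 0"
    using loc u local_ordering_less_zero[OF loc]
    by (intro LM_eqI) (auto simp: local_ordering_def normal_ordering_def in_keys_iff)
  then show ?thesis
    using u by (auto simp: S_prec_def)
qed

text \<open>
  In the expansion of \<open>s * g\<close> along the monomials of \<open>s\<close>, the constant term contributes a nonzero
  multiple of \<open>g\<close>, and by normality all monomials of the other contributions lie below the leading
  monomial of \<open>g\<close>.
\<close>

lemma LM_mult_S_prec:
  fixes s g :: "('n::finite, 'k::field) polynomial"
  assumes loc: "local_ordering TYPE('k) prec" and s: "s \<in> S_prec prec" and g: "g \<noteq> 0"
  shows "LM prec (s * g) = LM prec g"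
proof -
  have ord: "strict_total_order prec"
    using loc by (simp add: local_ordering_def normal_ordering_def)
  have s0: "0 \<in> Poly_Mapping.keys s"
    using s LM_greatest(1)[OF ord, of s] by (auto simp: S_prec_def)
  have "s * g = (\<Sum>\<alpha>\<in>Poly_Mapping.keys s. Poly_Mapping.single \<alpha> (Poly_Mapping.lookup s \<alpha>)) * g"
    by (simp add: sum_single_lookup)
  also have "\<dots> = (\<Sum>\<alpha>\<in>Poly_Mapping.keys s. scale_poly (Poly_Mapping.lookup s \<alpha>) (monom_poly \<alpha> * g))"
    by (simp add: sum_distrib_right scale_poly_def monom_poly_def mult_single flip: mult.assoc)
  finally have expand: "Poly_Mapping.lookup (s * g) m =
      (\<Sum>\<alpha>\<in>Poly_Mapping.keys s.
        Poly_Mapping.lookup s \<alpha> * Poly_Mapping.lookup (monom_poly \<alpha> * g) m)" for m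
    by (simp add: lookup_sum lookup_scale_poly)
  have below: "prec m (LM prec g)"
    if "\<alpha> \<noteq> 0" "m \<in> Poly_Mapping.keys (monom_poly \<alpha> * g)" for m \<alpha>
  proof -
    have "prec (LM prec (monom_poly \<alpha> * g)) (LM prec g)"
      using loc g local_ordering_less_zero[OF loc \<open>\<alpha> \<noteq> 0\<close>]
      by (simp add: local_ordering_def normal_ordering_def)
    moreover have "monom_poly \<alpha> * g \<noteq> 0"
      using that(2) by auto
    ultimately show ?thesis
      using LM_greatest(2)[OF ord _ that(2)] ord by (metis strict_total_order_def transpD)
  qed
  have irrefl: "\<not> prec m m" for m
    using ord by (meson strict_total_order_def irreflpD)
  show ?thesis
  proof (rule LM_eqI[OF ord])
    have "Poly_Mapping.lookup (monom_poly \<alpha> * g) (LM prec g) = 0" if "\<alpha> \<noteq> 0" for \<alpha>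
      using below[OF that] irrefl by (meson in_keys_iff)
    then have "Poly_Mapping.lookup (s * g) (LM prec g) =
        (\<Sum>\<alpha>\<in>Poly_Mapping.keys s. if \<alpha> = 0
          then Poly_Mapping.lookup s 0 * Poly_Mapping.lookup g (LM prec g) else 0)"
      unfolding expand by (intro sum.cong) (auto simp: monom_poly_def single_one)
    also have "\<dots> = Poly_Mapping.lookup s 0 * Poly_Mapping.lookup g (LM prec g)"
      using s0 by simp
    also have "\<dots> \<noteq> 0"
      using s0 LM_greatest(1)[OF ord g] by (simp add: in_keys_iff)
    finally show "LM prec g \<in> Poly_Mapping.keys (s * g)"
      by (simp add: in_keys_iff)
  next
    fix m assume m: "m \<in> Poly_Mapping.keys (s * g)" "m \<noteq> LM prec g"
    then obtain \<alpha> where \<alpha>: "m \<in> Poly_Mapping.keys (monom_poly \<alpha> * g)"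
      unfolding in_keys_iff expand by (metis (no_types, lifting) mult_zero_right sum.neutral)
    show "prec m (LM prec g)"
    proof (cases "\<alpha> = 0")
      case True
      then have "m \<in> Poly_Mapping.keys g"
        using \<alpha> by (simp add: monom_poly_def single_one)
      then show ?thesis
        using m(2) LM_greatest(2)[OF ord g] by blast
    qed (use below \<alpha> in blast)
  qed
qed

section \<open>The closure of an ideal\<close>

lemma mem_ideal_closure_iff:
  fixes g :: "('n::linorder, 'k::field) polynomial"
  shows "g \<in> ideal_closure prec I \<longleftrightarrow> (\<exists>s\<in>S_prec prec. s * g \<in> I)"
proof -
  have "to_fract g = Fract f s \<longleftrightarrow> f = s * g" if "s \<in> S_prec prec" for f s
    using that by (auto simp: S_prec_def to_fract_def eq_fract mult.commute)
  then show ?thesis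
    unfolding ideal_closure_def localisation_def mem_Collect_eq by metis
qed

lemma ideal_subset_closure:
  fixes I :: "('n::{finite,linorder}, 'k::field) polynomial set"
  assumes "local_ordering TYPE('k) prec"
  shows "I \<subseteq> ideal_closure prec I"
proof
  fix g assume "g \<in> I"
  moreover have "(1 :: ('n, 'k) polynomial) \<in> S_prec prec"
    using assms by (rule S_precI) simp
  ultimately show "g \<in> ideal_closure prec I"
    unfolding mem_ideal_closure_iff by (metis mult_1)
qed

lemma L_set_closure_subset:
  fixes I :: "('n::{finite,linorder}, 'k::field) polynomial set"
  assumes I: "is_ideal I" and loc: "local_ordering TYPE('k) prec"
    and G: "G \<subseteq> ideal_closure prec I"
  shows "L_set prec G \<subseteq> L_ideal prec I"
proof
  fix m assume "m \<in> L_set prec G"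
  then obtain \<alpha> g where g: "g \<in> G" "g \<noteq> 0" and m: "m = LM prec (monom_poly \<alpha> * g)"
    by (auto simp: L_set_def)
  obtain s where s: "s \<in> S_prec prec" "s * g \<in> I"
    using g(1) G mem_ideal_closure_iff by blast
  have nz: "monom_poly \<alpha> * g \<noteq> 0"
    using g(2) by (simp add: monom_poly_neq_0)
  have "s * (monom_poly \<alpha> * g) \<in> I"
    using I s(2) unfolding is_ideal_def by (metis mult.left_commute)
  moreover have "s * (monom_poly \<alpha> * g) \<noteq> 0"
    using nz s(1) by (auto simp: S_prec_def)
  moreover have "m = LM prec (s * (monom_poly \<alpha> * g))"
    using LM_mult_S_prec[OF loc s(1) nz] m by simp
  ultimately show "m \<in> L_ideal prec I"
    unfolding L_ideal_def by blast
qed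

section \<open>Powers of the variables\<close>

lemma is_ideal_sum:
  assumes "is_ideal I" "\<And>x. x \<in> A \<Longrightarrow> f x \<in> I"
  shows "sum f A \<in> I"
  using assms(2)
  by (induction A rule: infinite_finite_induct) (use assms(1) in \<open>auto simp: is_ideal_def\<close>)

text \<open>
  Represent each \<open>F k\<close> modulo \<open>I\<close> by some \<open>b k\<close> in the span of a fixed finite set \<open>B\<close>; any
  \<open>card B + 1\<close> of these, counted with repetition, satisfy a linear relation.
\<close>

lemma zero_dimensional_combination_in_ideal:
  fixes F :: "nat \<Rightarrow> ('n, 'k::field) polynomial"
  assumes I: "is_ideal I" and "zero_dimensional I"
  obtains c N where "(\<Sum>k\<le>N. scale_poly (c k) (F k)) \<in> I" and "\<exists>k\<le>(N::nat). c k \<noteq> 0"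
proof -
  obtain B where B: "finite B"
      "UNIV // ideal_cong I = (\<lambda>f. ideal_cong I `` {f}) ` poly_space.span B"
    using assms(2) by (auto simp: zero_dimensional_def)
  have "\<exists>b. b \<in> poly_space.span B \<and> F k - b \<in> I" for k
  proof -
    have "ideal_cong I `` {F k} \<in> UNIV // ideal_cong I"
      by (simp add: quotientI)
    then obtain b where b: "b \<in> poly_space.span B" "ideal_cong I `` {F k} = ideal_cong I `` {b}"
      using B(2) by blast
    have "b \<in> ideal_cong I `` {b}"
      using I by (simp add: ideal_cong_def is_ideal_def)
    then show ?thesis
      using b by (auto simp: ideal_cong_def)
  qed
  then obtain b where b: "\<And>k. b k \<in> poly_space.span B" "\<And>k. F k - b k \<in> I"
    by metis
  define N where "N = card B"
  have "\<exists>c. (\<exists>k\<le>N. c k \<noteq> 0) \<and> (\<Sum>k\<le>N. scale_poly (c k) (b k)) = 0"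
  proof (cases "inj_on b {..N}")
    case True
    have "\<not> poly_space.independent (b ` {..N})"
    proof
      assume "poly_space.independent (b ` {..N})"
      then have "card (b ` {..N}) \<le> card B"
        using poly_space.independent_span_bound[OF B(1)] b(1) by blast
      then show False
        using True by (simp add: card_image N_def)
    qed
    then obtain u where u: "\<exists>v\<in>b ` {..N}. u v \<noteq> 0" "(\<Sum>v\<in>b ` {..N}. scale_poly (u v) v) = 0"
      by (subst (asm) poly_space.dependent_finite) auto
    then show ?thesis
      using True by (intro exI[of _ "u \<circ> b"]) (auto simp: sum.reindex)
  next
    case False
    then obtain i j where ij: "i \<le> N" "j \<le> N" "i \<noteq> j" "b i = b j"
      by (auto simp: inj_on_def)
    define c :: "nat \<Rightarrow> 'k" where "c k = (if k = i then 1 else 0) - (if k = j then 1 else 0)" for k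
    have "scale_poly (c k) (b k) = (if k = i then b k else 0) - (if k = j then b k else 0)" for k
      by (auto simp: c_def)
    then have "(\<Sum>k\<le>N. scale_poly (c k) (b k)) = 0"
      using ij by (simp add: sum_subtractf)
    moreover have "c i \<noteq> 0"
      using ij by (simp add: c_def)
    ultimately show ?thesis
      using ij(1) by blast
  qed
  then obtain c where c: "\<exists>k\<le>N. c k \<noteq> 0" "(\<Sum>k\<le>N. scale_poly (c k) (b k)) = 0"
    by blast
  have "(\<Sum>k\<le>N. scale_poly (c k) (F k - b k)) \<in> I"
    using I b(2) by (intro is_ideal_sum) (auto simp: scale_poly_def is_ideal_def)
  then have "(\<Sum>k\<le>N. scale_poly (c k) (F k)) \<in> I"
    using c(2) by (simp add: poly_space.scale_right_diff_distrib sum_subtractf)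
  then show thesis
    using c(1) that by blast
qed

text \<open>
  A nonzero polynomial in the single variable \<open>x\<^sub>i\<close> is its lowest power of \<open>x\<^sub>i\<close> times a
  polynomial with nonzero constant term, i.e. times an element of \<open>S_prec prec\<close>.
\<close>

lemma variable_power_in_closure:
  fixes I :: "('n::{finite,linorder}, 'k::field) polynomial set"
  assumes "is_ideal I" "zero_dimensional I" and loc: "local_ordering TYPE('k) prec"
  shows "\<exists>d. monom_poly (Poly_Mapping.single i d) \<in> ideal_closure prec I"
proof -
  let ?x = "\<lambda>k. monom_poly (Poly_Mapping.single i k) :: ('n, 'k) polynomial"
  obtain c N where cI: "(\<Sum>k\<le>N. scale_poly (c k) (?x k)) \<in> I" and "\<exists>k\<le>N. c k \<noteq> 0"
    by (rule zero_dimensional_combination_in_ideal[OF assms(1,2), of ?x]) blast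
  define d where "d = (LEAST k. k \<le> N \<and> c k \<noteq> 0)"
  have d: "d \<le> N \<and> c d \<noteq> 0"
    unfolding d_def by (rule LeastI_ex) fact
  have below_d: "c k = 0" if "k < d" for k
    using not_less_Least[OF that[unfolded d_def]] that d by auto
  define u where "u = (\<Sum>k\<in>{d..N}. scale_poly (c k) (?x (k - d)))"
  have "u * ?x d = (\<Sum>k\<in>{d..N}. scale_poly (c k) (?x k))"
    unfolding u_def sum_distrib_right
    by (intro sum.cong) (simp_all add: scale_poly_def mult.assoc monom_poly_mult flip: single_add)
  also have "\<dots> = (\<Sum>k\<le>N. scale_poly (c k) (?x k))"
    using below_d by (intro sum.mono_neutral_left) auto
  finally have "u * ?x d \<in> I"
    using cI by simp
  moreover have "u \<in> S_prec prec"
  proof (rule S_precI[OF loc])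
    have "Poly_Mapping.lookup u 0 = (\<Sum>k\<in>{d..N}. if k = d then c d else 0)"
      unfolding u_def lookup_sum
      by (intro sum.cong)
        (auto simp: scale_poly_def monom_poly_def mult_single lookup_single when_def
          dest: arg_cong[where f = "\<lambda>p. Poly_Mapping.lookup p i"])
    then show "Poly_Mapping.lookup u 0 \<noteq> 0"
      using d by simp
  qed
  ultimately show ?thesis
    unfolding mem_ideal_closure_iff by blast
qed

section \<open>Existence of a standard basis\<close>

lemma finite_bounded_monomials:
  fixes d :: "'n::finite \<Rightarrow> nat"
  shows "finite {m :: 'n monomial. \<forall>i. Poly_Mapping.lookup m i < d i}"
proof (rule finite_imageD)
  have "Poly_Mapping.lookup ` {m :: 'n monomial. \<forall>i. Poly_Mapping.lookup m i < d i}
      \<subseteq> Pi\<^sub>E UNIV (\<lambda>i. {..<d i})"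
    by auto
  then show "finite (Poly_Mapping.lookup ` {m :: 'n monomial. \<forall>i. Poly_Mapping.lookup m i < d i})"
    by (rule finite_subset) (simp add: finite_PiE)
qed (simp add: inj_on_def poly_mapping_eqI)

theorem proposition4p1:
  fixes I :: "('n::{finite,linorder}, 'k::field) polynomial set"
    and prec :: "'n monomial \<Rightarrow> 'n monomial \<Rightarrow> bool"
  assumes "is_ideal I"
    and "zero_dimensional I"
    and "local_ordering TYPE('k) prec"
  shows "\<exists>G. standard_basis prec I G"
proof -
  have ord: "strict_total_order prec"
    using assms(3) by (simp add: local_ordering_def normal_ordering_def)
  obtain d where d: "\<And>i. monom_poly (Poly_Mapping.single i (d i)) \<in> ideal_closure prec I"
    using variable_power_in_closure[OF assms] by metis
  define M where "M = {m \<in> L_ideal prec I. \<forall>i. Poly_Mapping.lookup m i < d i}"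
  have "\<forall>m\<in>M. \<exists>g. g \<in> I \<and> g \<noteq> 0 \<and> LM prec g = m"
    by (auto simp: M_def L_ideal_def)
  then obtain p where p: "\<And>m. m \<in> M \<Longrightarrow> p m \<in> I \<and> p m \<noteq> 0 \<and> LM prec (p m) = m"
    by metis
  define G where "G = range (\<lambda>i. monom_poly (Poly_Mapping.single i (d i))) \<union> p ` M"
  have "finite M"
    by (rule finite_subset[OF _ finite_bounded_monomials[of d]]) (auto simp: M_def)
  then have "finite G"
    by (simp add: G_def)
  moreover have G: "G \<subseteq> ideal_closure prec I"
    using d p ideal_subset_closure[OF assms(3), of I] by (auto simp: G_def)
  moreover have "L_ideal prec I \<subseteq> L_set prec G"
  proof
    fix m assume m: "m \<in> L_ideal prec I"
    show "m \<in> L_set prec G"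
    proof (cases "m \<in> M")
      case True
      then have "m = LM prec (monom_poly 0 * p m)" "p m \<in> G" "p m \<noteq> 0"
        using p by (auto simp: G_def monom_poly_def single_one)
      then show ?thesis
        unfolding L_set_def by blast
    next
      case False
      then obtain i where i: "d i \<le> Poly_Mapping.lookup m i"
        using m by (auto simp: M_def not_less)
      let ?g = "monom_poly (Poly_Mapping.single i (d i)) :: ('n, 'k) polynomial"
      have "m - Poly_Mapping.single i (d i) + Poly_Mapping.single i (d i) = m"
        using i by (intro poly_mapping_eqI)
          (auto simp: lookup_add lookup_minus lookup_single when_def)
      then have "m = LM prec (monom_poly (m - Poly_Mapping.single i (d i)) * ?g)"
        by (simp add: monom_poly_mult LM_monom_poly[OF ord])
      moreover have "?g \<in> G" "?g \<noteq> 0"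
        by (auto simp: G_def monom_poly_neq_0)
      ultimately show ?thesis
        unfolding L_set_def by blast
    qed
  qed
  ultimately have "standard_basis prec I G"
    unfolding standard_basis_def using L_set_closure_subset[OF assms(1,3) G] by blast
  then show ?thesis ..
qed

end
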